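(* Let $q=3^d$ with $d\geq 1$ and let $E\colon y^2=x^3+a_4x+a_6$ be a supersingular elliptic curve over $\mathbb{F}_q$ (so $a_4\ne 0$). Suppose $d$ is odd. If $-a_4=v^4$ for some $v\in\mathbb{F}_q^\times$, then \[\#E(\mathbb{F}_q)=\begin{cases} q+1 & \text{if } \operatorname{Tr}(a_6v^{-6})=0,\\ q+1+\sqrt{3q} & \text{if } \operatorname{Tr}(a_6v^{-6})=1 \text{ and } d\equiv1\pmod 4,\\ q+1-\sqrt{3q} & \text{if } \operatorname{Tr}(a_6v^{-6})=1 \text{ and } d\equiv3\pmod 4,\\ q+1-\sqrt{3q} & \text{if } \operatorname{Tr}(a_6v^{-6})=-1 \text{ and } d\equiv1\pmod 4,\\ q+1+\sqrt{3q} & \text{if } \operatorname{Tr}(a_6v^{-6})=-1 \text{ and } d\equiv3\pmod 4. \end{cases}\] Otherwise (if $-a_4$ is not a fourth power in $\mathbb{F}_q^\times$), $\#E(\mathbb{F}_q)=q+1$. Suppose $d$ is even. If $-a_4=\gamma^2$ for some $\gamma\in\mathbb{F}_q^\times$ and $\gamma$ is a square in $\mathbb{F}_q^\times$, then \[\#E(\mathbb{F}_q)=\begin{cases} q+1-2\sqrt q & \text{if } \operatorname{Tr}(a_6\gamma^{-3})=0 \text{ and } d\equiv0\pmod4,\\ q+1+2\sqrt q & \text{if } \operatorname{Tr}(a_6\gamma^{-3})=0 \text{ and } d\equiv2\pmod4,\\ q+1+\sqrt q & \text{if } \operatorname{Tr}(a_6\gamma^{-3})\neq0 \text{ and } d\equiv0\pmod4,\\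 q+1-\sqrt q & \text{if } \operatorname{Tr}(a_6\gamma^{-3})\neq0 \text{ and } d\equiv2\pmod4. \end{cases}\] If $-a_4=\gamma^2$ for some $\gamma\in\mathbb{F}_q^\times$ and $\gamma$ is not a square in $\mathbb{F}_q^\times$, then \[\#E(\mathbb{F}_q)=\begin{cases} q+1+2\sqrt q & \text{if } \operatorname{Tr}(a_6\gamma^{-3})=0 \text{ and } d\equiv0\pmod4,\\ q+1-2\sqrt q & \text{if } \operatorname{Tr}(a_6\gamma^{-3})=0 \text{ and } d\equiv2\pmod4,\\ q+1-\sqrt q & \text{if } \operatorname{Tr}(a_6\gamma^{-3})\neq0 \text{ and } d\equiv0\pmod4,\\ q+1+\sqrt q & \text{if } \operatorname{Tr}(a_6\gamma^{-3})\neq0 \text{ and } d\equiv2\pmod4. \end{cases}\] Finally, if $-a_4$ is not a square in $\mathbb{F}_q^\times$, then $\#E(\mathbb{F}_q)=q+1$.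
   Context: $\operatorname{Tr}$ denotes the trace map $\mathbb{F}_q\to\mathbb{F}_3$, with $\mathbb{F}_3=\{0,1,-1\}$. $\#E(\mathbb{F}_q)$ counts all $\mathbb{F}_q$-rational points, including the point at infinity. *)

theory Defs
  imports Complex_Main "HOL-Algebra.Algebraic_Closure_Type" "HOL-Number_Theory.Residues"
    "HOL-Library.Cardinality"
begin

text \<open>
  Throughout, the pair \<open>a, b\<close> stands for the curve \<open>y\<^sup>2 = x\<^sup>3 + a x + b\<close> over a field of
  characteristic different from 2.
\<close>

datatype 'a ec_point = Infinity | Affine 'a 'a

definition ec_points :: "'a::field \<Rightarrow> 'a \<Rightarrow> 'a ec_point set" where
  "ec_points a b = insert Infinity {Affine x y | x y. y ^ 2 = x ^ 3 + a * x + b}"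

text \<open>
  Smoothness is tested on geometric points: no point over the algebraic closure annihilates both
  partial derivatives. The point at infinity is always smooth.
\<close>

definition elliptic_curve :: "'a::field \<Rightarrow> 'a \<Rightarrow> bool" where
  "elliptic_curve a b \<longleftrightarrow>
     (\<forall>x y :: 'a alg_closure. y ^ 2 = x ^ 3 + to_ac a * x + to_ac b \<longrightarrow>
        \<not> (2 * y = 0 \<and> 3 * x ^ 2 + to_ac a = 0))"

text \<open>The chord-and-tangent law; it does not depend on \<open>b\<close>.\<close>

fun ec_add :: "'a::field \<Rightarrow> 'a ec_point \<Rightarrow> 'a ec_point \<Rightarrow> 'a ec_point" where
  "ec_add a Infinity Q = Q"
| "ec_add a (Affine x1 y1) Infinity = Affine x1 y1"
| "ec_add a (Affine x1 y1) (Affine x2 y2) =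
     (if x1 = x2 \<and> y1 = - y2 then Infinity
      else let m = (if x1 = x2 then (3 * x1 ^ 2 + a) / (2 * y1) else (y2 - y1) / (x2 - x1));
               x3 = m ^ 2 - x1 - x2
           in Affine x3 (m * (x1 - x3) - y1))"

definition ec_mult :: "'a::field \<Rightarrow> nat \<Rightarrow> 'a ec_point \<Rightarrow> 'a ec_point" where
  "ec_mult a n P = (ec_add a P ^^ n) Infinity"

text \<open>
  Supersingular: there is no nontrivial geometric point of order dividing the characteristic.
\<close>

definition supersingular :: "'a::field \<Rightarrow> 'a \<Rightarrow> bool" where
  "supersingular a b \<longleftrightarrow>
     (\<forall>P \<in> ec_points (to_ac a) (to_ac b). ec_mult (to_ac a) CHAR('a) P = Infinity \<longrightarrow> P = Infinity)"

text \<open>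
  The trace from the field with \<open>3 ^ d\<close> elements to its prime field, as the sum of the
  conjugates. Its values lie in the copy \<open>{0, 1, -1}\<close> of the prime field inside the large field,
  see \<open>trace3_range\<close> below.
\<close>

definition trace3 :: "nat \<Rightarrow> 'a::field \<Rightarrow> 'a" where
  "trace3 d x = (\<Sum>i<d. x ^ (3 ^ i))"

lemma CHAR_eq_3:
  assumes "CARD('a::finite_field) = 3 ^ d"
  shows "CHAR('a) = 3"
proof -
  have "CHAR('a) dvd 3 ^ d"
    using CHAR_dvd_CARD[where ?'a = 'a] assms by simp
  moreover have "prime CHAR('a)"
    by simp
  ultimately have "CHAR('a) dvd 3"
    using prime_dvd_power by blast
  with \<open>prime CHAR('a)\<close> show ?thesis
    by (intro primes_dvd_imp_eq) auto
qed

lemma trace3_range: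
  fixes x :: "'a::finite_field"
  assumes "CARD('a) = 3 ^ d"
  shows "trace3 d x \<in> {0, 1, -1}"
proof -
  have ch: "CHAR('a) = 3"
    using assms by (rule CHAR_eq_3)
  have "trace3 d x ^ 3 = (\<Sum>i<d. (x ^ (3 ^ i)) ^ 3)"
    unfolding trace3_def by (rule freshmans_dream_sum) (simp_all add: ch)
  also have "\<dots> = (\<Sum>i<d. x ^ (3 ^ Suc i))"
    by (simp only: power_mult [symmetric] power_Suc2)
  also have "\<dots> = (\<Sum>i<Suc d. x ^ (3 ^ i)) - x"
    by (simp only: sum.lessThan_Suc_shift power_0 power_one_right add_diff_cancel_left')
  also have "\<dots> = trace3 d x"
    using finite_field_power_card_eq_same[of x] assms by (simp add: trace3_def)
  finally have "trace3 d x * (trace3 d x - 1) * (trace3 d x + 1) = 0"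
    by (simp add: algebra_simps power3_eq_cube)
  then show ?thesis
    by (auto simp: eq_neg_iff_add_eq_0)
qed

lemma three_eq_0_closure:
  assumes "CHAR('a::field) = 3"
  shows "(3 :: 'a alg_closure) = 0"
proof -
  have "of_nat 3 = (0 :: 'a)"
    using assms by (simp only: of_nat_eq_0_iff_char_dvd) simp
  then have "to_ac (of_nat 3 :: 'a) = 0"
    by (simp only: to_ac_0)
  then show ?thesis
    by simp
qed

lemma elliptic_curve_iff:
  fixes a b :: "'a::field"
  assumes "CHAR('a) = 3"
  shows "elliptic_curve a b \<longleftrightarrow> a \<noteq> 0"
proof
  assume E: "elliptic_curve a b"
  show "a \<noteq> 0"
  proof
    assume "a = 0"
    obtain x where "poly [:to_ac b, 0, 0, 1:] x = 0"
      using alg_closed_imp_poly_has_root[of "[:to_ac b, 0, 0, 1:]"] by auto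
    then have "0 ^ 2 = x ^ 3 + to_ac a * x + to_ac b"
      using \<open>a = 0\<close> by (simp add: power3_eq_cube algebra_simps)
    then show False
      using E \<open>a = 0\<close> three_eq_0_closure[OF assms] unfolding elliptic_curve_def
      by (metis add_0 mult_zero_left mult_zero_right to_ac_0)
  qed
qed (auto simp: elliptic_curve_def three_eq_0_closure[OF assms])

lemma elliptic_curve_imp_supersingular:
  fixes a b :: "'a::field"
  assumes "CHAR('a) = 3" "elliptic_curve a b"
  shows "supersingular a b"
  unfolding supersingular_def
proof (intro ballI impI)
  fix P assume P: "P \<in> ec_points (to_ac a) (to_ac b)"
    and "ec_mult (to_ac a) CHAR('a) P = Infinity"
  then have 3: "ec_add (to_ac a) P (ec_add (to_ac a) P (ec_add (to_ac a) P Infinity)) = Infinity"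
    using assms(1) by (simp add: ec_mult_def eval_nat_numeral)
  show "P = Infinity"
  proof (cases P)
    case (Affine x y)
    have z: "(3 :: 'a alg_closure) = 0"
      by (rule three_eq_0_closure[OF assms(1)])
    have two: "(2 :: 'a alg_closure) \<noteq> 0"
    proof
      assume "(2 :: 'a alg_closure) = 0"
      moreover have "(3 :: 'a alg_closure) = 2 + 1" by simp
      ultimately show False using z by simp
    qed
    have a: "to_ac a \<noteq> 0"
      using assms elliptic_curve_iff[of a b] by simp
    have y: "y \<noteq> - y"
    proof
      assume "y = - y"
      then have "y = 0"
        using two by (metis eq_neg_iff_add_eq_0 mult_2 mult_eq_0_iff)
      then show False using 3 Affine by simp
    qed
    then have "y \<noteq> 0" by auto
    define m where "m = to_ac a / (2 * y)"
    have "ec_add (to_ac a) P (ec_add (to_ac a) P Infinity)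
            = Affine (m ^ 2 - x - x) (m * (x - (m ^ 2 - x - x)) - y)"
      using Affine y z by (simp add: m_def Let_def)
    then have "x = m ^ 2 - x - x"
      using 3 Affine by (auto simp: Let_def split: if_splits)
    then have "m ^ 2 = 3 * x"
      by (simp add: algebra_simps)
    then have "m = 0"
      using z by simp
    then show ?thesis
      using a two \<open>y \<noteq> 0\<close> by (simp add: m_def)
  qed
qed

end

theory Submission
  imports Defs "Jordan_Normal_Form.Determinant"
begin

text \<open>
  The map \<open>x \<mapsto> x\<^sup>3 + a\<^sub>4 x\<close> is additive. If \<open>- a\<^sub>4\<close> is not a square it is bijective, so every
  \<open>y\<close> carries one point. If \<open>- a\<^sub>4 = g\<^sup>2\<close>, substituting \<open>x = g u\<close> and additive Hilbert 90 show that
  \<open>y\<close> carries three points or none, according to whether \<open>Tr (y\<^sup>2 / g\<^sup>3) = Tr (a\<^sub>6 / g\<^sup>3)\<close>. Replacing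
  \<open>y\<close> by \<open>g\<^sup>2 y\<close> leaves the values of the quadratic form \<open>Tr (g y\<^sup>2)\<close> over the prime field to be
  counted.

  For \<open>g = 1\<close> the counts follow from the Gauss sum of \<open>Tr (y\<^sup>2)\<close>, which splits along an orthogonal
  basis into a product of \<open>d\<close> factors \<open>\<plusminus> \<i> \<surd>3\<close>; the product of the signs is the discriminant of the
  trace form. That discriminant is \<open>(- 1) ^ (d - 1)\<close>, because Frobenius permutes the conjugates of
  the basis cyclically. A nonsquare \<open>g\<close> is handled by complementation: \<open>y\<^sup>2\<close> and \<open>g y\<^sup>2\<close> together
  take every value exactly twice.
\<close>

section \<open>Fibres of additive maps and sorting points by ordinate\<close>

text \<open>Translation by one preimage of \<open>s\<close> carries the kernel onto the fibre over
  \<open>s\<close>. The domain is the disjoint union of the fibres over the range, all of this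
  common size.\<close>

lemma card_eq_card_range_times_card_kernel:
  fixes f :: "'a::{finite, ab_group_add} \<Rightarrow> 'b::ab_group_add"
  assumes add: "\<And>x y. f (x + y) = f x + f y"
  shows "\<And>s. s \<in> range f \<Longrightarrow> card {x. f x = s} = card {x. f x = 0}"
    and "CARD('a) = card (range f) * card {x. f x = 0}"
proof -
  show fiber: "card {x. f x = s} = card {x. f x = 0}" if "s \<in> range f" for s
  proof -
    obtain x0 where x0: "s = f x0" using \<open>s \<in> range f\<close> by auto
    have diff: "f (x - y) = f x - f y" for x y
      using add[of "x - y" y] by (simp add: algebra_simps)
    have "bij_betw (\<lambda>x. x + x0) {x. f x = 0} {x. f x = s}"
      by (rule bij_betw_byWitness[where f' = "\<lambda>x. x - x0"]) (auto simp: add diff x0)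
    then show ?thesis by (simp add: bij_betw_same_card)
  qed
  have "CARD('a) = card (\<Union>s\<in>range f. {x. f x = s})"
    by (rule arg_cong[where f = card]) auto
  also have "\<dots> = (\<Sum>s\<in>range f. card {x. f x = s})"
    by (rule card_UN_disjoint) auto
  also have "\<dots> = card (range f) * card {x. f x = 0}"
    by (simp add: fiber)
  finally show "CARD('a) = card (range f) * card {x. f x = 0}" .
qed

lemma card_Collect_comp:
  fixes f :: "'a::finite \<Rightarrow> 'b::finite"
  shows "card {y. P (f y)} = (\<Sum>x | P x. card {y. f y = x})"
proof -
  have "card {y. P (f y)} = card (\<Union>x\<in>{x. P x}. {y. f y = x})"
    by (rule arg_cong[where f = card]) auto
  also have "\<dots> = (\<Sum>x | P x. card {y. f y = x})"
    by (rule card_UN_disjoint) auto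
  finally show ?thesis .
qed

text \<open>The points are sorted by \<open>y\<close> rather than by \<open>x\<close>: for fixed
  \<open>y\<close> the equation in \<open>x\<close> describes a fibre of
  \<open>x ^ 3 + a * x\<close>, which is additive in characteristic 3.\<close>

lemma card_ec_points:
  fixes a b :: "'a::finite_field"
  shows "card (ec_points a b) = 1 + (\<Sum>y\<in>UNIV. card {x. x ^ 3 + a * x = y ^ 2 - b})"
proof -
  let ?A = "\<lambda>y. (\<lambda>x. Affine x y) ` {x. x ^ 3 + a * x = y ^ 2 - b}"
  have points: "ec_points a b = insert Infinity (\<Union>y. ?A y)"
    by (auto simp: ec_points_def image_iff algebra_simps)
  have "card (ec_points a b) = 1 + card (\<Union>y. ?A y)"
    unfolding points by (subst card_insert_disjoint) auto
  also have "card (\<Union>y. ?A y) = (\<Sum>y\<in>UNIV. card (?A y))"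
    by (rule card_UN_disjoint) auto
  also have "\<dots> = (\<Sum>y\<in>UNIV. card {x. x ^ 3 + a * x = y ^ 2 - b})"
    by (intro sum.cong refl card_image) (auto intro: inj_onI)
  finally show ?thesis .
qed

section \<open>A cubic character of the prime field\<close>

definition omega :: complex where
  "omega = Complex (- 1 / 2) (sqrt 3 / 2)"

text \<open>A function on the whole field, but a character only on the prime field \<open>{0, 1, -1}\<close>.\<close>

definition char3 :: "'a::field \<Rightarrow> complex" where
  "char3 x = (if x = 0 then 1 else if x = 1 then omega else cnj omega)"

lemma omega_mult:
  "omega * omega = cnj omega" "cnj omega * cnj omega = omega"
  "omega * cnj omega = 1" "cnj omega * omega = 1"
  by (simp_all add: omega_def complex_eq_iff)

lemma i_sqrt_3_square: "(\<i> * complex_of_real (sqrt 3)) ^ 2 = complex_of_real (- 3)"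
  by (simp add: power_mult_distrib flip: of_real_power)

section \<open>Characteristic 3 and the trace map\<close>

context
  fixes d :: nat
  assumes card_field: "CARD('a::finite_field) = 3 ^ d"
begin

abbreviation Tr :: "'a \<Rightarrow> 'a" where "Tr \<equiv> trace3 d"

lemma d_pos: "0 < d"
proof (rule ccontr)
  assume "\<not> 0 < d"
  then have "CARD('a) = 1" using card_field by simp
  then have "(0::'a) = 1" by (metis card_1_singletonE UNIV_I singletonD)
  then show False by simp
qed

lemma char_field: "CHAR('a) = 3"
  using card_field by (rule CHAR_eq_3)

lemma three_eq_0: "(3::'a) = 0"
  using of_nat_CHAR[where 'a = 'a] char_field by simp

lemma one_plus_one: "(1::'a) + 1 = - 1"
  using three_eq_0 by (simp add: eq_neg_iff_add_eq_0)

lemma one_neq_minus_one: "(1::'a) \<noteq> - 1"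
proof
  assume "(1::'a) = - 1"
  then have "(1::'a) + 1 = 1" using one_plus_one by metis
  then show False by (metis add_cancel_left_left zero_neq_one)
qed

lemma two_neq_0: "(2::'a) \<noteq> 0"
  using one_plus_one by (metis neg_equal_0_iff_equal one_add_one zero_neq_one)

lemma card_prime_field: "card {0, 1, - 1 :: 'a} = 3"
  using one_neq_minus_one by simp

lemma cube_add: "(x + y) ^ 3 = x ^ 3 + y ^ 3" for x y :: 'a
  by (rule freshmans_dream) (simp_all add: char_field)

lemma power_3_power_add: "(x + y) ^ (3 ^ i) = x ^ (3 ^ i) + y ^ (3 ^ i)" for x y :: 'a
  by (rule freshmans_dream') (simp_all add: char_field)

lemma power_card: "x ^ (3 ^ d) = x" for x :: 'a
  using finite_field_power_card_eq_same[of x] card_field by simp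

lemma trace_add: "Tr (x + y) = Tr x + Tr y"
  by (simp add: trace3_def power_3_power_add sum.distrib)

lemma trace_0: "Tr 0 = 0"
  by (simp add: trace3_def power_0_left)

lemma trace_minus: "Tr (- x) = - Tr x"
  using trace_add[of x "- x"] by (simp add: trace_0 eq_neg_iff_add_eq_0 add.commute)

lemma trace_diff: "Tr (x - y) = Tr x - Tr y"
  using trace_add[of x "- y"] by (simp add: trace_minus)

lemma trace_sum: "Tr (sum f A) = (\<Sum>i\<in>A. Tr (f i))"
  by (induction A rule: infinite_finite_induct) (simp_all add: trace_0 trace_add)

lemma trace_range: "Tr x \<in> {0, 1, - 1}"
  by (rule trace3_range[OF card_field])

lemma trace_scale: "c \<in> {0, 1, - 1} \<Longrightarrow> Tr (c * x) = c * Tr x"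
  by (auto simp: trace_0 trace_minus)

lemma trace_cube: "Tr (x ^ 3) = Tr x"
proof -
  have "Tr (x ^ 3) = (\<Sum>i<d. x ^ (3 ^ Suc i))"
    by (simp add: trace3_def power_mult [symmetric])
  also have "\<dots> = (\<Sum>i<Suc d. x ^ (3 ^ i)) - x"
    by (simp only: sum.lessThan_Suc_shift power_0 power_one_right add_diff_cancel_left')
  also have "\<dots> = Tr x"
    by (simp add: trace3_def power_card)
  finally show ?thesis .
qed

text \<open>The trace is given by a polynomial of degree at most \<open>3 ^ (d - 1)\<close>, nonzero
  because its coefficient of X is 1. It has too few roots to vanish on all \<open>3 ^ d\<close>
  elements.\<close>

lemma trace_nonzero: "\<exists>x. Tr x \<noteq> 0"
proof (rule ccontr)
  assume "\<not> ?thesis"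
  then have zero: "Tr x = 0" for x by simp
  define p :: "'a poly" where "p = (\<Sum>i<d. monom 1 (3 ^ i))"
  have "coeff p 1 = (\<Sum>i<d. if i = 0 then 1 else 0)"
    unfolding p_def coeff_sum by (rule sum.cong) auto
  also have "\<dots> = 1" using d_pos by simp
  finally have "p \<noteq> 0" by auto
  moreover have "degree p \<le> 3 ^ (d - 1)"
    unfolding p_def
    by (rule degree_sum_le) (auto intro!: order.trans[OF degree_monom_le] power_increasing)
  ultimately have "card {x. poly p x = 0} \<le> 3 ^ (d - 1)"
    using card_poly_roots_bound[of p] by (meson order.trans)
  moreover have "poly p x = Tr x" for x
    by (simp add: p_def trace3_def poly_sum poly_monom)
  then have "{x. poly p x = 0} = UNIV" using zero by simp
  ultimately have "3 ^ d \<le> (3::nat) ^ (d - 1)"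
    by (simp only: card_field)
  moreover have "(3::nat) ^ (d - 1) < 3 ^ d" using d_pos by simp
  ultimately show False by linarith
qed

lemma range_trace: "range Tr = {0, 1, - 1}"
proof -
  obtain x where "Tr x \<noteq> 0" using trace_nonzero by blast
  then have "Tr x = 1 \<and> Tr (- x) = - 1 \<or> Tr x = - 1 \<and> Tr (- x) = 1"
    using trace_range[of x] by (auto simp: trace_minus)
  then have "{0, 1, - 1} \<subseteq> range Tr"
    using trace_0 by (auto intro: range_eqI sym)
  then show ?thesis using trace_range by blast
qed

lemma card_trace_fiber:
  assumes "t \<in> {0, 1, - 1}"
  shows "3 * card {x. Tr x = t} = CARD('a)"
proof -
  have "card {x. Tr x = t} = card {x. Tr x = 0}"
    using assms by (intro card_eq_card_range_times_card_kernel(1) trace_add)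
      (simp only: range_trace)
  moreover have "CARD('a) = card (range Tr) * card {x. Tr x = 0}"
    by (intro card_eq_card_range_times_card_kernel(2) trace_add)
  ultimately show ?thesis
    by (simp only: range_trace card_prime_field)
qed

section \<open>Artin-Schreier equations\<close>

lemma cube_diff_fixed_iff: "u ^ 3 - u = 0 \<longleftrightarrow> u \<in> {0, 1, - 1}" for u :: 'a
proof -
  have "u ^ 3 - u = u * (u - 1) * (u + 1)"
    by (simp add: algebra_simps power3_eq_cube)
  then show ?thesis by (auto simp: eq_neg_iff_add_eq_0)
qed

text \<open>This is additive Hilbert 90 in counted form. The map \<open>u ^ 3 - u\<close> has the
  prime field as kernel, and its image lies in the kernel of the trace; both subgroups have
  \<open>3 ^ d / 3\<close> elements, so they coincide.\<close>

lemma card_artin_schreier_fiber: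
  "card {u :: 'a. u ^ 3 - u = s} = (if Tr s = 0 then 3 else 0)"
proof -
  define f :: "'a \<Rightarrow> 'a" where "f u = u ^ 3 - u" for u
  have add: "f (x + y) = f x + f y" for x y by (simp add: f_def cube_add)
  have "{u. f u = 0} = {0, 1, - 1}"
    unfolding f_def cube_diff_fixed_iff by auto
  then have ker: "card {u. f u = 0} = 3" using card_prime_field by simp
  have "range f \<subseteq> {x. Tr x = 0}"
    by (auto simp: f_def trace_diff trace_cube)
  moreover have "card {x. Tr x = 0} = card (range f)"
    using card_eq_card_range_times_card_kernel(2)[OF add] card_trace_fiber[of 0] ker by simp
  ultimately have "range f = {x. Tr x = 0}"
    by (intro card_subset_eq) auto
  then have "s \<in> range f \<longleftrightarrow> Tr s = 0" by simp
  show ?thesis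
  proof (cases "Tr s = 0")
    case True
    then have "card {u. f u = s} = 3"
      using card_eq_card_range_times_card_kernel(1)[OF add] \<open>s \<in> range f \<longleftrightarrow> _\<close> ker by metis
    then show ?thesis using True by (simp add: f_def)
  next
    case False
    then have "{u. f u = s} = {}" using \<open>s \<in> range f \<longleftrightarrow> _\<close> by blast
    then show ?thesis using False by (simp add: f_def)
  qed
qed

section \<open>Character values and one-dimensional Gauss sums\<close>

lemma char3_add:
  assumes "x \<in> {0, 1, - 1}" "y \<in> {0, 1, - 1 :: 'a}"
  shows "char3 (x + y) = char3 x * char3 y"
proof -
  have "(- 1 :: 'a) + - 1 = 1"
    using one_plus_one by (metis add.inverse_inverse minus_add_distrib)
  then show ?thesis
    using assms one_plus_one one_neq_minus_one one_neq_minus_one[symmetric]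
    by (auto simp: char3_def omega_mult)
qed

text \<open>Both \<open>c = 1\<close> and \<open>c = - 1\<close> contribute \<open>char3 a\<close>,
  so the sum is \<open>1 + 2 * omega\<close> or its conjugate.\<close>

lemma sum_char3_squares:
  assumes "a \<in> {1, - 1 :: 'a}"
  shows "(\<Sum>c\<in>{0, 1, - 1}. char3 (c ^ 2 * a)) = \<i> * sqrt 3 * (if a = 1 then 1 else - 1)"
  using assms one_neq_minus_one one_neq_minus_one[symmetric]
  by (auto simp: char3_def omega_def complex_eq_iff)

section \<open>Orthogonal bases of the trace form\<close>

text \<open>Only the values of \<open>e\<close> below \<open>n\<close> matter. Requiring them to be
  anisotropic forces linear independence over the prime field, since pairing with \<open>e j\<close>
  isolates the coefficient of \<open>e j\<close>.\<close>

definition orthogonal_family :: "nat \<Rightarrow> (nat \<Rightarrow> 'a) \<Rightarrow> bool" where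
  "orthogonal_family n e \<longleftrightarrow>
     (\<forall>i<n. Tr (e i * e i) \<noteq> 0) \<and> (\<forall>i<n. \<forall>j<n. i \<noteq> j \<longrightarrow> Tr (e i * e j) = 0)"

text \<open>A Gram-Schmidt step. The orthogonal complement of the family is nonzero for reasons of
  size, and it contains an anisotropic vector: otherwise polarization would make the form vanish on
  it, against nondegeneracy.\<close>

lemma orthogonal_family_extend:
  assumes "orthogonal_family n e" "n < d"
  shows "\<exists>x. orthogonal_family (Suc n) (e(n := x))"
proof -
  define c where "c x i = Tr (e i * x) / Tr (e i * e i)" for x i
  \<comment> \<open>\<open>p\<close> is the orthogonal projection onto the span of the first
    \<open>n\<close> vectors, with the Gram-Schmidt coefficients \<open>c\<close>.\<close>
  define p where "p x = (\<Sum>i<n. c x i * e i)" for x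
  have nz: "Tr (e i * e i) \<noteq> 0" if "i < n" for i
    using assms that by (simp add: orthogonal_family_def)
  have orth: "Tr (e i * e j) = 0" if "i < n" "j < n" "i \<noteq> j" for i j
    using assms that by (simp add: orthogonal_family_def)
  \<comment> \<open>The prime field is closed under division. No bound on \<open>i\<close> is
    required, because division by zero yields 0.\<close>
  have c: "c x i \<in> {0, 1, - 1}" for x i
    using trace_range[of "e i * x"] trace_range[of "e i * e i"] by (auto simp: c_def)
  have Tr_p: "Tr (z * p x) = (\<Sum>i<n. c x i * Tr (z * e i))" for x z
  proof -
    have "Tr (z * p x) = (\<Sum>i<n. Tr (c x i * (z * e i)))"
      by (simp add: p_def trace_sum [symmetric] sum_distrib_left mult_ac)
    then show ?thesis by (simp add: trace_scale[OF c])
  qed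
  have perp: "Tr (e j * (x - p x)) = 0" if "j < n" for j x
  proof -
    have "Tr (e j * p x) = (\<Sum>i<n. if i = j then c x j * Tr (e j * e j) else 0)"
      unfolding Tr_p by (rule sum.cong) (auto simp: orth that)
    also have "\<dots> = Tr (e j * x)" using that nz by (simp add: c_def)
    finally show ?thesis by (simp add: right_diff_distrib trace_diff)
  qed
  \<comment> \<open>If the projection were the identity, the at most \<open>3 ^ n\<close>
    combinations of the \<open>e i\<close> would exhaust a field of \<open>3 ^ d\<close>
    elements.\<close>
  have "\<exists>x. x - p x \<noteq> 0"
  proof (rule ccontr)
    assume "\<not> ?thesis"
    then have "x = p x" for x by simp
    then have "UNIV = range p" by (metis surj_def)
    also have "range p \<subseteq> (\<lambda>g. \<Sum>i<n. g i * e i) ` PiE {..<n} (\<lambda>_. {0, 1, - 1})"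
    proof
      fix y assume "y \<in> range p"
      then obtain x where "y = p x" by auto
      then show "y \<in> (\<lambda>g. \<Sum>i<n. g i * e i) ` PiE {..<n} (\<lambda>_. {0, 1, - 1})"
        using c by (intro image_eqI[of _ _ "restrict (c x) {..<n}"]) (auto simp: p_def)
    qed
    finally have "CARD('a) \<le> card ((\<lambda>g. \<Sum>i<n. g i * e i) ` PiE {..<n} (\<lambda>_. {0, 1, - 1}))"
      by (intro card_mono) (auto intro: finite_PiE)
    also have "\<dots> \<le> card (PiE {..<n} (\<lambda>_. {0, 1, - 1 :: 'a}))"
      by (intro card_image_le finite_PiE) auto
    also have "\<dots> = 3 ^ n"
      using card_prime_field by (simp add: card_PiE)
    finally show False using card_field \<open>n < d\<close> by simp
  qed
  then obtain x0 where x0: "x0 - p x0 \<noteq> 0" by blast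
  have "\<exists>w. (\<forall>j<n. Tr (e j * w) = 0) \<and> Tr (w * w) \<noteq> 0"
  proof (rule ccontr)
    assume "\<not> ?thesis"
    then have iso: "Tr (w * w) = 0" if "\<And>j. j < n \<Longrightarrow> Tr (e j * w) = 0" for w
      using that by blast
    define w where "w = x0 - p x0"
    have w: "Tr (e j * w) = 0" if "j < n" for j using perp that by (simp add: w_def)
    \<comment> \<open>Split \<open>z\<close> into \<open>p z\<close>, which is orthogonal to
      \<open>w\<close>, and a remainder \<open>v\<close> in the complement. Since \<open>w\<close>,
      \<open>v\<close> and \<open>w + v\<close> are all isotropic,
      \<open>2 * Tr (w * v) = 0\<close>.\<close>
    have "Tr (w * z) = 0" for z
    proof -
      define v where "v = z - p z"
      have v: "Tr (e j * v) = 0" if "j < n" for j using perp that by (simp add: v_def)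
      have "Tr ((w + v) * (w + v)) = 0"
        using w v by (intro iso) (simp add: distrib_left trace_add)
      moreover have "Tr ((w + v) * (w + v)) = Tr (w * w) + Tr (v * v) + 2 * Tr (w * v)"
        by (simp only: distrib_left distrib_right trace_add mult.commute[of v w] mult_2 add_ac)
      ultimately have "Tr (w * v) = 0"
        using iso[OF w] iso[OF v] two_neq_0 by simp
      moreover have "Tr (w * p z) = 0"
        unfolding Tr_p using w by (simp add: mult.commute)
      ultimately show ?thesis
        using trace_add[of "w * v" "w * p z"] by (simp add: v_def algebra_simps)
    qed
    \<comment> \<open>Multiplication by the nonzero \<open>w\<close> is onto, so the trace would
      vanish identically.\<close>
    from this[of "_ / w"] have "Tr z = 0" for z
      using x0 by (simp add: w_def)
    then show False using trace_nonzero by blast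
  qed
  then obtain w where "\<And>j. j < n \<Longrightarrow> Tr (e j * w) = 0" "Tr (w * w) \<noteq> 0" by blast
  then have "orthogonal_family (Suc n) (e(n := w))"
    using nz orth unfolding orthogonal_family_def
    by (auto simp: less_Suc_eq mult.commute)
  then show ?thesis ..
qed

lemma orthogonal_family_exists: "n \<le> d \<Longrightarrow> \<exists>e. orthogonal_family n e"
proof (induction n)
  case 0
  show ?case by (auto simp: orthogonal_family_def)
next
  case (Suc n)
  then show ?case using orthogonal_family_extend by fastforce
qed

text \<open>
  With \<open>M\<close> the matrix of conjugates of the \<open>e i\<close>, the product is \<open>det M ^ 2\<close>. Frobenius
  permutes the rows of \<open>M\<close> cyclically, so \<open>det M ^ 3 = (- 1) ^ (d - 1) * det M\<close>.
\<close>

lemma orthogonal_family_discriminant: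
  assumes "orthogonal_family d e"
  shows "(\<Prod>i<d. Tr (e i * e i)) = (- 1) ^ (d - 1)"
proof -
  define M where "M = mat d d (\<lambda>(j, i). e i ^ (3 ^ j))"
  have M: "M \<in> carrier_mat d d" by (simp add: M_def)
  \<comment> \<open>\<open>G\<close> is the Gram matrix of the trace form: summing the products of
    the conjugates of \<open>e i\<close> and \<open>e j\<close> gives \<open>Tr (e i * e j)\<close>.
    Orthogonality makes it diagonal.\<close>
  define G where "G = transpose_mat M * M"
  have G: "G \<in> carrier_mat d d" using M by (simp add: G_def)
  have G_entry: "G $$ (i, j) = Tr (e i * e j)" if "i < d" "j < d" for i j
    using that
    by (simp add: G_def M_def scalar_prod_def trace3_def power_mult_distrib atLeast0LessThan)
  have "det G = prod_list (diag_mat G)"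
    using assms by (intro det_lower_triangular[OF _ G])
      (simp add: G_entry orthogonal_family_def)
  also have "\<dots> = (\<Prod>i<d. Tr (e i * e i))"
    using G by (simp add: prod_list_diag_prod G_entry atLeast0LessThan)
  finally have det_G: "det G = (\<Prod>i<d. Tr (e i * e i))" .
  have det_sq: "det G = det M ^ 2"
    using M by (simp add: G_def det_mult[of _ d] det_transpose[of _ d] power2_eq_square)
  interpret frob: comm_ring_hom "\<lambda>x :: 'a. x ^ 3"
    by unfold_locales (simp_all add: cube_add power_mult_distrib)
  define F where "F = map_mat (\<lambda>x. x ^ 3) M"
  have F: "F \<in> carrier_mat d d" using M by (simp add: F_def)
  have F_entry: "F $$ (j, i) = e i ^ (3 ^ Suc j)" if "i < d" "j < d" for i j
    using that by (simp add: F_def M_def power_mult [symmetric] mult.commute)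
  \<comment> \<open>The last row of \<open>F\<close> has the entries
    \<open>e i ^ (3 ^ d) = e i\<close>, which form the first row of \<open>M\<close>. Moving it to
    the front takes \<open>d - 1\<close> adjacent swaps.\<close>
  have "swap_row_to_front F (d - 1) = M"
    using d_pos F M
    by (subst swap_row_to_front_result[OF F])
      (auto intro!: eq_matI simp: F_entry M_def power_card simp del: power_Suc)
  then have "det M = (- 1) ^ (d - 1) * det F"
    using swap_row_to_front_det[OF F, of "d - 1"] d_pos by simp
  also have "det F = det M ^ 3"
    unfolding F_def by (rule frob.hom_det)
  finally have "det M = (- 1) ^ (d - 1) * det M ^ 2 * det M"
    by (simp add: power3_eq_cube power2_eq_square)
  moreover have "det M \<noteq> 0"
    using assms det_G det_sq by (auto simp: orthogonal_family_def)
  ultimately have "(- 1) ^ (d - 1) * det M ^ 2 = 1" by simp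
  then show ?thesis
    using det_G det_sq by (metis left_minus_one_mult_self mult.right_neutral)
qed

text \<open>Pairing with \<open>e j\<close> recovers the coordinate \<open>g j\<close>, which gives
  injectivity; surjectivity follows because there are exactly \<open>3 ^ d\<close> coordinate
  vectors.\<close>

lemma orthogonal_family_coordinates:
  assumes "orthogonal_family d e"
  shows "bij_betw (\<lambda>g. \<Sum>i<d. g i * e i) (PiE {..<d} (\<lambda>_. {0, 1, - 1})) UNIV"
proof -
  define P where "P = PiE {..<d} (\<lambda>_. {0, 1, - 1 :: 'a})"
  define s where "s g = (\<Sum>i<d. g i * e i)" for g
  have coeff: "Tr (s g * e j) = g j * Tr (e j * e j)" if "g \<in> P" "j < d" for g j
  proof -
    have g: "g i \<in> {0, 1, - 1}" if "i < d" for i using \<open>g \<in> P\<close> that by (auto simp: P_def)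
    have "Tr (s g * e j) = (\<Sum>i<d. Tr (g i * (e i * e j)))"
      by (simp add: s_def trace_sum [symmetric] sum_distrib_right mult.assoc)
    also have "\<dots> = (\<Sum>i<d. if i = j then g j * Tr (e j * e j) else 0)"
      using assms g that
      by (intro sum.cong refl) (simp add: trace_scale orthogonal_family_def)
    finally show ?thesis using that by simp
  qed
  have inj: "inj_on s P"
  proof (rule inj_onI)
    fix g h assume gh: "g \<in> P" "h \<in> P" "s g = s h"
    have "g i = h i" if "i < d" for i
      using coeff[of g i] coeff[of h i] gh assms that by (simp add: orthogonal_family_def)
    then show "g = h" using gh by (intro PiE_ext) (auto simp: P_def)
  qed
  have "card P = CARD('a)"
    using card_prime_field by (simp add: P_def card_PiE card_field)
  then have "card (s ` P) = CARD('a)"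
    using inj by (simp add: card_image)
  then have "s ` P = UNIV"
    by (intro card_subset_eq) auto
  then show ?thesis
    using inj by (simp add: bij_betw_def P_def s_def [abs_def])
qed

section \<open>The quadratic Gauss sum of the trace form\<close>

lemma sum_char3_trace_square:
  "(\<Sum>y\<in>UNIV. char3 (Tr (y ^ 2))) = (\<i> * sqrt 3) ^ d * (- 1) ^ (d - 1)"
proof -
  obtain e where e: "orthogonal_family d e" using orthogonal_family_exists by blast
  define P where "P = PiE {..<d} (\<lambda>_. {0, 1, - 1 :: 'a})"
  define a where "a i = Tr (e i * e i)" for i
  \<comment> \<open>\<sigma> carries signs from the finite field to the complex numbers; it is
    multiplicative on \<open>{1, - 1}\<close>, which is where it is applied.\<close>
  define \<sigma> :: "'a \<Rightarrow> complex" where "\<sigma> x = (if x = 1 then 1 else - 1)" for x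
  have a: "a i \<in> {1, - 1}" if "i < d" for i
    using e that trace_range[of "e i * e i"] by (auto simp: a_def orthogonal_family_def)
  have sq: "Tr ((\<Sum>i<d. g i * e i) ^ 2) = (\<Sum>i<d. g i ^ 2 * a i)"
    if "g \<in> P" for g
  proof -
    have g: "g i \<in> {0, 1, - 1}" if "i < d" for i using \<open>g \<in> P\<close> that by (auto simp: P_def)
    have "Tr ((\<Sum>i<d. g i * e i) ^ 2) = (\<Sum>i<d. \<Sum>j<d. Tr (g i * (g j * (e i * e j))))"
      by (simp add: power2_eq_square sum_product trace_sum [symmetric] mult_ac)
    also have "\<dots> = (\<Sum>i<d. \<Sum>j<d. if j = i then g i ^ 2 * a i else 0)"
      using e g
      by (intro sum.cong refl)
        (simp add: trace_scale orthogonal_family_def a_def power2_eq_square)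
    finally show ?thesis by simp
  qed
  \<comment> \<open>Membership of the partial sums in the prime field is carried through the
    induction because \<open>char3_add\<close> requires it.\<close>
  have add: "char3 (\<Sum>i\<in>A. g i ^ 2 * a i) = (\<Prod>i\<in>A. char3 (g i ^ 2 * a i))
      \<and> (\<Sum>i\<in>A. g i ^ 2 * a i) \<in> {0, 1, - 1}"
    if g: "g \<in> P" and "finite A" "A \<subseteq> {..<d}" for g A
    using \<open>finite A\<close> \<open>A \<subseteq> {..<d}\<close>
  proof (induction A rule: finite_induct)
    case empty
    show ?case by (simp add: char3_def)
  next
    case (insert i A)
    have gi: "g i \<in> {0, 1, - 1}" using g insert.prems by (auto simp: P_def)
    then have m: "g i ^ 2 * a i \<in> {0, 1, - 1}" using a[of i] insert.prems by auto
    have IH: "char3 (\<Sum>i\<in>A. g i ^ 2 * a i) = (\<Prod>i\<in>A. char3 (g i ^ 2 * a i))"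
      "(\<Sum>i\<in>A. g i ^ 2 * a i) \<in> {0, 1, - 1}"
      using insert by auto
    have "- 1 + - 1 = (1::'a)"
      using one_plus_one by (metis add.inverse_inverse minus_add_distrib)
    then have "g i ^ 2 * a i + (\<Sum>i\<in>A. g i ^ 2 * a i) \<in> {0, 1, - 1}"
      using m IH(2) one_plus_one by (elim insertE emptyE) simp_all
    then show ?case
      using insert.hyps char3_add[OF m IH(2)] IH(1) by simp
  qed
  have \<sigma>_prod: "\<sigma> (\<Prod>i\<in>A. a i) = (\<Prod>i\<in>A. \<sigma> (a i)) \<and> (\<Prod>i\<in>A. a i) \<in> {1, - 1}"
    if "finite A" "A \<subseteq> {..<d}" for A
    using that
  proof (induction A rule: finite_induct)
    case (insert i A)
    then show ?case
      using a[of i] one_neq_minus_one one_neq_minus_one[symmetric] by (auto simp: \<sigma>_def)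
  qed (simp add: \<sigma>_def)
  have "(\<Sum>y\<in>UNIV. char3 (Tr (y ^ 2))) = (\<Sum>g\<in>P. char3 (Tr ((\<Sum>i<d. g i * e i) ^ 2)))"
    using sum.reindex_bij_betw[OF orthogonal_family_coordinates[OF e],
        of "\<lambda>y. char3 (Tr (y ^ 2))"]
    by (simp add: P_def)
  also have "\<dots> = (\<Sum>g\<in>P. \<Prod>i<d. char3 (g i ^ 2 * a i))"
    using add[of _ "{..<d}"] by (intro sum.cong refl) (simp add: sq)
  \<comment> \<open>Distributivity turns the sum over all coordinate vectors into a product of
    one-dimensional Gauss sums.\<close>
  also have "\<dots> = (\<Prod>i<d. \<Sum>c\<in>{0, 1, - 1}. char3 (c ^ 2 * a i))"
    unfolding P_def by (rule prod_sum_PiE [symmetric]) auto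
  also have "\<dots> = (\<Prod>i<d. \<i> * sqrt 3 * \<sigma> (a i))"
    using a by (intro prod.cong refl) (simp only: sum_char3_squares \<sigma>_def lessThan_iff)
  also have "\<dots> = (\<i> * sqrt 3) ^ d * (\<Prod>i<d. \<sigma> (a i))"
    by (simp add: prod.distrib power_mult_distrib)
  also have "(\<Prod>i<d. \<sigma> (a i)) = \<sigma> ((- 1) ^ (d - 1))"
    using \<sigma>_prod[of "{..<d}"] orthogonal_family_discriminant[OF e] by (simp add: a_def)
  also have "\<dots> = (- 1) ^ (d - 1)"
    using one_neq_minus_one by (cases "even (d - 1)") (auto simp: \<sigma>_def)
  finally show ?thesis .
qed

section \<open>Squares and nonsquares\<close>

lemma card_square_roots:
  assumes "w \<noteq> (0::'a)"
  shows "card {y. y ^ 2 = w ^ 2} = 2"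
proof -
  have "w \<noteq> - w"
    using assms two_neq_0 by (metis eq_neg_iff_add_eq_0 mult_2 mult_eq_0_iff)
  moreover have "{y. y ^ 2 = w ^ 2} = {w, - w}"
    by (auto simp: power2_eq_iff)
  ultimately show ?thesis by simp
qed

text \<open>The nonzero squares \<open>Q\<close> make up half of the unit group, as each has two
  roots. The coset of \<open>Q\<close> by a nonsquare \<open>g\<close> is disjoint from
  \<open>Q\<close> and of the same size, so it is the other half.\<close>

lemma nonsquare_quotient:
  assumes "x \<noteq> (0::'a)" "\<nexists>y. x = y ^ 2" "\<nexists>y. g = y ^ 2"
  shows "\<exists>y. x = g * y ^ 2"
proof -
  define Q where "Q = (\<lambda>y :: 'a. y ^ 2) ` (- {0})"
  have "g \<noteq> 0" using assms(3) by (metis zero_power2)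
  have "- {0 :: 'a} = (\<Union>s\<in>Q. {y. y ^ 2 = s})"
    by (auto simp: Q_def)
  then have "card (- {0 :: 'a}) = card (\<Union>s\<in>Q. {y. y ^ 2 = s})" by simp
  also have "\<dots> = (\<Sum>s\<in>Q. card {y. y ^ 2 = s})"
    by (rule card_UN_disjoint) auto
  also have "\<dots> = 2 * card Q"
  proof -
    have "card {y. y ^ 2 = s} = 2" if "s \<in> Q" for s
      using that card_square_roots unfolding Q_def by blast
    then show ?thesis by simp
  qed
  finally have "card (- {0 :: 'a}) = 2 * card Q" .
  moreover have "card ((*) g ` Q) = card Q"
    using \<open>g \<noteq> 0\<close> by (intro card_image inj_onI) simp
  moreover have "Q \<inter> (*) g ` Q = {}"
  proof (rule ccontr)
    assume "Q \<inter> (*) g ` Q \<noteq> {}"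
    then obtain y z where "y ^ 2 = g * z ^ 2" "z \<noteq> 0" by (auto simp: Q_def)
    then have "g = (y / z) ^ 2" by (simp add: power_divide)
    then show False using assms(3) by blast
  qed
  ultimately have "card (Q \<union> (*) g ` Q) = card (- {0 :: 'a})"
    by (simp add: card_Un_disjoint)
  then have "Q \<union> (*) g ` Q = - {0}"
    using \<open>g \<noteq> 0\<close> by (intro card_subset_eq) (auto simp: Q_def)
  then have "x \<in> Q \<union> (*) g ` Q" using assms(1) by blast
  then show ?thesis using assms(2) by (auto simp: Q_def)
qed

text \<open>Cubing sends a square root \<open>y\<close> of -1 to \<open>- y\<close>. For odd
  \<open>d\<close> the \<open>d\<close>-fold iterate, which is the identity, would then also negate
  \<open>y\<close>.\<close>

lemma minus_one_nonsquare:
  assumes "odd d"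
  shows "(- 1 :: 'a) \<noteq> y ^ 2"
proof
  assume y: "- 1 = y ^ 2"
  have "y ^ (3 ^ n) = (- 1) ^ n * y" for n
  proof (induction n)
    case (Suc n)
    have "y ^ (3 ^ Suc n) = (y ^ (3 ^ n)) ^ 3"
      by (simp add: power_mult [symmetric] mult.commute)
    also have "\<dots> = ((- 1) ^ n * (- 1) ^ n) * (- 1) ^ n * (y ^ 2 * y)"
      unfolding Suc.IH by (simp add: power_mult_distrib power3_eq_cube power2_eq_square mult_ac)
    also have "\<dots> = (- 1) ^ Suc n * y"
      unfolding y [symmetric] by simp
    finally show ?case .
  qed simp
  from this[of d] have "y = - y" using assms power_card[of y] by simp
  then have "y = 0"
    using two_neq_0 by (metis eq_neg_iff_add_eq_0 mult_2 mult_eq_0_iff)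
  then show False using y by simp
qed

section \<open>Value distribution of the forms \<open>Tr (g * y ^ 2)\<close>\<close>

definition trace_count :: "'a \<Rightarrow> 'a \<Rightarrow> nat" where
  "trace_count g t = card {y. Tr (g * y ^ 2) = t}"

lemma trace_count_square:
  assumes "w \<noteq> 0"
  shows "trace_count (w ^ 2) t = trace_count 1 t"
proof -
  have "bij_betw ((*) w) {y. Tr (w ^ 2 * y ^ 2) = t} {y. Tr (y ^ 2) = t}"
    using assms
    by (intro bij_betw_byWitness[where f' = "\<lambda>y. y / w"])
      (auto simp: power_mult_distrib power_divide)
  then show ?thesis by (simp add: trace_count_def bij_betw_same_card)
qed

text \<open>Under \<open>y ^ 2\<close> and \<open>g * y ^ 2\<close> together every \<open>x\<close>
  has two preimages: zero has one under each, a nonzero square two under the first, a nonsquare two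
  under the second. Summing over a trace fibre gives the claim.\<close>

lemma trace_count_nonsquare:
  assumes "\<nexists>y. g = y ^ 2" "t \<in> {0, 1, - 1}"
  shows "3 * trace_count g t + 3 * trace_count 1 t = 2 * 3 ^ d"
proof -
  have "g \<noteq> 0" using assms(1) by (metis zero_power2)
  have two: "card {y. g * y ^ 2 = x} + card {y. y ^ 2 = x} = 2" for x
  proof (cases "x = 0")
    case True
    then show ?thesis using \<open>g \<noteq> 0\<close> by simp
  next
    case False
    show ?thesis
    proof (cases "\<exists>w. x = w ^ 2")
      case True
      then obtain w where w: "x = w ^ 2" by blast
      have "g * y ^ 2 \<noteq> x" for y
      proof
        assume "g * y ^ 2 = x"
        then have "g = (w / y) ^ 2"
          using False w by (auto simp: power_divide eq_divide_eq)
        then show False using assms(1) by blast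
      qed
      moreover have "card {y. y ^ 2 = x} = 2"
        using False w card_square_roots[of w] by auto
      ultimately show ?thesis by simp
    next
      case nonsq: False
      then obtain w where w: "x = g * w ^ 2"
        using nonsquare_quotient[of x g] assms(1) False by blast
      then have "{y. g * y ^ 2 = x} = {y. y ^ 2 = w ^ 2}"
        using \<open>g \<noteq> 0\<close> by simp
      moreover have "{y. y ^ 2 = x} = {}" using nonsq by auto
      ultimately show ?thesis
        using card_square_roots[of w] w False by auto
    qed
  qed
  have "trace_count g t + trace_count 1 t =
      (\<Sum>x | Tr x = t. card {y. g * y ^ 2 = x} + card {y. y ^ 2 = x})"
    using card_Collect_comp[of "\<lambda>x. Tr x = t" "\<lambda>y. g * y ^ 2"]
      card_Collect_comp[of "\<lambda>x. Tr x = t" "\<lambda>y. y ^ 2"]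
    by (simp add: trace_count_def sum.distrib)
  also have "\<dots> = 2 * card {x. Tr x = t}"
    unfolding two by simp
  finally show ?thesis
    using card_trace_fiber[OF assms(2)] card_field by simp
qed

lemma trace_count_total: "trace_count 1 0 + trace_count 1 1 + trace_count 1 (- 1) = 3 ^ d"
proof -
  have "(\<Sum>t\<in>{0, 1, - 1}. trace_count 1 t) = card (\<Union>t\<in>{0, 1, - 1}. {y. Tr (y ^ 2) = t})"
    unfolding trace_count_def mult_1 by (rule card_UN_disjoint [symmetric]) auto
  also have "(\<Union>t\<in>{0, 1, - 1}. {y. Tr (y ^ 2) = t}) = UNIV"
    using trace_range by blast
  finally show ?thesis
    using one_neq_minus_one by (simp add: card_field)
qed

lemma sum_char3_trace_count:
  "(\<Sum>y\<in>UNIV. char3 (Tr (y ^ 2))) =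
     of_nat (trace_count 1 0) + of_nat (trace_count 1 1) * omega
       + of_nat (trace_count 1 (- 1)) * cnj omega"
proof -
  have "(\<Sum>y\<in>UNIV. char3 (Tr (y ^ 2))) =
      (\<Sum>t\<in>{0, 1, - 1}. \<Sum>y | y \<in> UNIV \<and> Tr (y ^ 2) = t. char3 (Tr (y ^ 2)))"
    by (rule sum.group [symmetric]) (use trace_range in auto)
  also have "\<dots> = (\<Sum>t\<in>{0, 1, - 1}. of_nat (trace_count 1 t) * char3 t)"
    by (simp add: trace_count_def)
  also have "\<dots> = of_nat (trace_count 1 0) + of_nat (trace_count 1 1) * omega
       + of_nat (trace_count 1 (- 1)) * cnj omega"
    using one_neq_minus_one one_neq_minus_one[symmetric] by (simp add: char3_def add.assoc)
  finally show ?thesis .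
qed

text \<open>For odd \<open>d\<close> the Gauss sum is the purely imaginary number
  \<open>(- 3) ^ k * \<i> * sqrt 3\<close>. Its real and imaginary parts and the total
  \<open>3 ^ d\<close> determine the three counts.\<close>

lemma trace_count_odd:
  assumes d: "d = 2 * k + 1"
  shows "3 * real (trace_count 1 0) = 3 ^ d"
    and "3 * real (trace_count 1 1) = 3 ^ d + 3 * (- 3) ^ k"
    and "3 * real (trace_count 1 (- 1)) = 3 ^ d - 3 * (- 3) ^ k"
proof -
  have "(\<i> * sqrt 3) ^ d * (- 1) ^ (d - 1) = complex_of_real ((- 3) ^ k) * (\<i> * sqrt 3)"
    unfolding d power_add power_mult i_sqrt_3_square by simp
  then have eq: "complex_of_real ((- 3) ^ k) * (\<i> * sqrt 3) =
     of_nat (trace_count 1 0) + of_nat (trace_count 1 1) * omega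
       + of_nat (trace_count 1 (- 1)) * cnj omega"
    using sum_char3_trace_square sum_char3_trace_count by simp
  have re: "0 = real (trace_count 1 0) - real (trace_count 1 1) / 2 - real (trace_count 1 (- 1)) / 2"
    using arg_cong[OF eq, of Re] by (simp add: omega_def)
  have "(- 3) ^ k * sqrt 3 = (real (trace_count 1 1) - real (trace_count 1 (- 1))) / 2 * sqrt 3"
    using arg_cong[OF eq, of Im] by (simp add: omega_def algebra_simps diff_divide_distrib)
  then have im: "2 * (- 3) ^ k = real (trace_count 1 1) - real (trace_count 1 (- 1))"
    by (simp only: mult_cancel_right) simp
  have total: "real (trace_count 1 0) + real (trace_count 1 1) + real (trace_count 1 (- 1)) = 3 ^ d"
    using arg_cong[OF trace_count_total, of real] by simp
  show "3 * real (trace_count 1 0) = 3 ^ d"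
    using re total by linarith
  show "3 * real (trace_count 1 1) = 3 ^ d + 3 * (- 3) ^ k"
    using re im total by linarith
  show "3 * real (trace_count 1 (- 1)) = 3 ^ d - 3 * (- 3) ^ k"
    using re im total by linarith
qed

text \<open>For even \<open>d\<close> the Gauss sum is the real number \<open>- ((- 3) ^ k)\<close>,
  the sign coming from the discriminant. Its vanishing imaginary part equates the counts at 1 and
  -1.\<close>

lemma trace_count_even:
  assumes d: "d = 2 * k"
  shows "3 * real (trace_count 1 0) = 3 ^ d - 2 * (- 3) ^ k"
    and "t \<in> {1, - 1} \<Longrightarrow> 3 * real (trace_count 1 t) = 3 ^ d + (- 3) ^ k"
proof -
  have "odd (d - 1)" using d d_pos by simp
  then have "(\<i> * sqrt 3) ^ d * (- 1) ^ (d - 1) = - complex_of_real ((- 3) ^ k)"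
    unfolding d power_mult i_sqrt_3_square by simp
  then have eq: "- complex_of_real ((- 3) ^ k) =
     of_nat (trace_count 1 0) + of_nat (trace_count 1 1) * omega
       + of_nat (trace_count 1 (- 1)) * cnj omega"
    using sum_char3_trace_square sum_char3_trace_count by simp
  have re: "- ((- 3) ^ k) =
      real (trace_count 1 0) - real (trace_count 1 1) / 2 - real (trace_count 1 (- 1)) / 2"
    using arg_cong[OF eq, of Re] by (simp add: omega_def)
  have im: "real (trace_count 1 1) = real (trace_count 1 (- 1))"
    using arg_cong[OF eq, of Im] by (simp add: omega_def)
  have total: "real (trace_count 1 0) + real (trace_count 1 1) + real (trace_count 1 (- 1)) = 3 ^ d"
    using arg_cong[OF trace_count_total, of real] by simp
  show "3 * real (trace_count 1 0) = 3 ^ d - 2 * (- 3) ^ k"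
    using re im total by linarith
  have "3 * real (trace_count 1 1) = 3 ^ d + (- 3) ^ k"
    using re im total by linarith
  then show "t \<in> {1, - 1} \<Longrightarrow> 3 * real (trace_count 1 t) = 3 ^ d + (- 3) ^ k"
    using im by auto
qed

section \<open>Point counts in terms of the trace form\<close>

lemma card_ec_points_nonsquare:
  fixes a b :: 'a
  assumes "a \<noteq> 0" "\<nexists>g. - a = g ^ 2"
  shows "card (ec_points a b) = 3 ^ d + 1"
proof -
  define f where "f x = x ^ 3 + a * x" for x
  have add: "f (x + y) = f x + f y" for x y
    by (simp add: f_def cube_add algebra_simps)
  \<comment> \<open>A nonzero kernel element would be a square root of \<open>- a\<close>.\<close>
  have "x = 0" if "f x = 0" for x
  proof (rule ccontr)
    assume "x \<noteq> 0"
    have "x * (x ^ 2 + a) = 0" using that by (simp add: f_def algebra_simps power3_eq_cube power2_eq_square)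
    then have "- a = x ^ 2" using \<open>x \<noteq> 0\<close> by (simp add: neg_eq_iff_add_eq_0 add.commute)
    then show False using assms(2) by blast
  qed
  moreover have "f 0 = 0" by (simp add: f_def)
  ultimately have "{x. f x = 0} = {0}" by blast
  then have ker: "card {x. f x = 0} = 1" by simp
  have "card (range f) = CARD('a)"
    using card_eq_card_range_times_card_kernel(2)[OF add] ker by simp
  then have "range f = UNIV" by (intro card_subset_eq) auto
  then have "card {x. f x = s} = 1" for s
    using card_eq_card_range_times_card_kernel(1)[OF add, of s] ker by simp
  then show ?thesis by (simp add: card_ec_points f_def card_field)
qed

lemma card_ec_points_square:
  fixes b g :: 'a
  assumes "g \<noteq> 0"
  shows "card (ec_points (- (g ^ 2)) b) = 1 + 3 * trace_count g (Tr (b / g ^ 3))"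
proof -
  have fiber: "card {x. x ^ 3 + - (g ^ 2) * x = s} = (if Tr (s / g ^ 3) = 0 then 3 else 0)" for s
  proof -
    have "bij_betw ((*) g) {u. u ^ 3 - u = s / g ^ 3} {x. x ^ 3 + - (g ^ 2) * x = s}"
      using assms
      by (intro bij_betw_byWitness[where f' = "\<lambda>x. x / g"])
        (auto simp: field_simps power2_eq_square power3_eq_cube)
    then show ?thesis
      using card_artin_schreier_fiber by (simp add: bij_betw_same_card[symmetric])
  qed
  have "(\<Sum>y\<in>UNIV. card {x. x ^ 3 + - (g ^ 2) * x = y ^ 2 - b}) =
      3 * card {y. Tr ((y ^ 2 - b) / g ^ 3) = 0}"
    unfolding fiber by (simp add: sum.If_cases)
  also have "{y. Tr ((y ^ 2 - b) / g ^ 3) = 0} = {y. Tr (y ^ 2 / g ^ 3) = Tr (b / g ^ 3)}"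
    by (simp add: diff_divide_distrib trace_diff)
  also have "card \<dots> = trace_count g (Tr (b / g ^ 3))"
  proof -
    have scale: "(g ^ 2 * y) ^ 2 / g ^ 3 = g * y ^ 2" for y
      using assms by (simp add: field_simps power2_eq_square power3_eq_cube)
    have "bij_betw ((*) (g ^ 2)) {y. Tr (g * y ^ 2) = t} {y. Tr (y ^ 2 / g ^ 3) = t}" for t
      using assms scale scale[of "_ / g ^ 2"]
      by (intro bij_betw_byWitness[where f' = "\<lambda>x. x / g ^ 2"]) auto
    then show ?thesis
      unfolding trace_count_def by (rule bij_betw_same_card [symmetric])
  qed
  finally show ?thesis by (simp only: card_ec_points)
qed

lemma trace_count_nonsquare_real:
  assumes "\<nexists>y. g = y ^ 2" "t \<in> {0, 1, - 1}"
  shows "3 * real (trace_count g t) = 2 * 3 ^ d - 3 * real (trace_count 1 t)"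
  using arg_cong[OF trace_count_nonsquare[OF assms], of real] by simp

text \<open>Since -1 is a nonsquare for odd \<open>d\<close>, one of \<open>g\<close> and
  \<open>- g\<close> is a square, and both have the same square. Hence squares and fourth powers
  coincide.\<close>

lemma square_of_square_odd:
  assumes "odd d" "g \<noteq> (0::'a)"
  shows "\<exists>v. g ^ 2 = v ^ 4"
proof (cases "\<exists>v. g = v ^ 2")
  case True
  then obtain v where "g = v ^ 2" by blast
  then have "g ^ 2 = v ^ 4" by (simp flip: power_mult)
  then show ?thesis ..
next
  case False
  then obtain v where "g = - 1 * v ^ 2"
    using nonsquare_quotient[of g "- 1"] assms minus_one_nonsquare by blast
  then have "g ^ 2 = v ^ 4" by (simp flip: power_mult)
  then show ?thesis ..
qed

end

section \<open>Assembling the cases\<close>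

theorem mainTheorem5:
  fixes a4 a6 :: "'a::finite_field" and d :: nat and q N :: real
  assumes d: "d \<ge> 1"
    and q: "q = 3 ^ d"
    and card: "real CARD('a) = q"
    and E: "elliptic_curve a4 a6" "supersingular a4 a6"
    and N: "N = real (card (ec_points a4 a6))"
  shows
    "(odd d \<longrightarrow>
       (\<forall>v. v \<noteq> 0 \<and> - a4 = v ^ 4 \<longrightarrow>
             (trace3 d (a6 / v ^ 6) = 0 \<longrightarrow> N = q + 1) \<and>
             (trace3 d (a6 / v ^ 6) = 1 \<and> d mod 4 = 1 \<longrightarrow> N = q + 1 + sqrt (3 * q)) \<and>
             (trace3 d (a6 / v ^ 6) = 1 \<and> d mod 4 = 3 \<longrightarrow> N = q + 1 - sqrt (3 * q)) \<and>
             (trace3 d (a6 / v ^ 6) = -1 \<and> d mod 4 = 1 \<longrightarrow> N = q + 1 - sqrt (3 * q)) \<and>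
             (trace3 d (a6 / v ^ 6) = -1 \<and> d mod 4 = 3 \<longrightarrow> N = q + 1 + sqrt (3 * q))) \<and>
       ((\<nexists>v. v \<noteq> 0 \<and> - a4 = v ^ 4) \<longrightarrow> N = q + 1)) \<and>
     (even d \<longrightarrow>
       (\<forall>\<gamma>. \<gamma> \<noteq> 0 \<and> - a4 = \<gamma> ^ 2 \<and> (\<exists>w. w \<noteq> 0 \<and> \<gamma> = w ^ 2) \<longrightarrow>
             (trace3 d (a6 / \<gamma> ^ 3) = 0 \<and> d mod 4 = 0 \<longrightarrow> N = q + 1 - 2 * sqrt q) \<and>
             (trace3 d (a6 / \<gamma> ^ 3) = 0 \<and> d mod 4 = 2 \<longrightarrow> N = q + 1 + 2 * sqrt q) \<and>
             (trace3 d (a6 / \<gamma> ^ 3) \<noteq> 0 \<and> d mod 4 = 0 \<longrightarrow> N = q + 1 + sqrt q) \<and>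
             (trace3 d (a6 / \<gamma> ^ 3) \<noteq> 0 \<and> d mod 4 = 2 \<longrightarrow> N = q + 1 - sqrt q)) \<and>
       (\<forall>\<gamma>. \<gamma> \<noteq> 0 \<and> - a4 = \<gamma> ^ 2 \<and> (\<nexists>w. w \<noteq> 0 \<and> \<gamma> = w ^ 2) \<longrightarrow>
             (trace3 d (a6 / \<gamma> ^ 3) = 0 \<and> d mod 4 = 0 \<longrightarrow> N = q + 1 + 2 * sqrt q) \<and>
             (trace3 d (a6 / \<gamma> ^ 3) = 0 \<and> d mod 4 = 2 \<longrightarrow> N = q + 1 - 2 * sqrt q) \<and>
             (trace3 d (a6 / \<gamma> ^ 3) \<noteq> 0 \<and> d mod 4 = 0 \<longrightarrow> N = q + 1 - sqrt q) \<and>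
             (trace3 d (a6 / \<gamma> ^ 3) \<noteq> 0 \<and> d mod 4 = 2 \<longrightarrow> N = q + 1 + sqrt q)) \<and>
       ((\<nexists>\<gamma>. \<gamma> \<noteq> 0 \<and> - a4 = \<gamma> ^ 2) \<longrightarrow> N = q + 1))"
proof -
  have card_nat: "CARD('a) = 3 ^ d"
    using card q by (metis of_nat_eq_iff of_nat_numeral of_nat_power)
  note points_sq = card_ec_points_square[OF card_nat]
    and points_nonsq = card_ec_points_nonsquare[OF card_nat]
  have a4: "a4 \<noteq> 0"
    using E(1) elliptic_curve_iff CHAR_eq_3[OF card_nat] by blast
  have N_nonsq: "N = q + 1" if "\<nexists>g. - a4 = g ^ 2"
    using points_nonsq[OF a4 that] N q by simp
  have N_sq: "N = 1 + 3 * real (trace_count d g (trace3 d (a6 / g ^ 3)))"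
    if "g \<noteq> 0" "- a4 = g ^ 2" for g
    using points_sq[OF that(1), of a6] N that(2) by (metis (no_types, lifting) minus_minus
        of_nat_1 of_nat_add of_nat_mult of_nat_numeral)
  have range: "trace3 d x \<in> {0, 1, - 1}" for x :: 'a
    by (rule trace3_range[OF card_nat])
  show ?thesis
  proof (intro conjI impI)
    assume "odd d"
    then obtain k where k: "d = 2 * k + 1" by (rule oddE)
    have root: "sqrt (3 * q) = 3 * 3 ^ k"
      by (rule real_sqrt_unique) (simp_all add: q k power_mult_distrib flip: power_mult)
    \<comment> \<open>With \<open>k\<close> half of \<open>d - 1\<close>, the residue of
      \<open>d\<close> modulo 4 decides the parity of \<open>k\<close> and hence the sign of the
      deviation from \<open>q + 1\<close>.\<close>
    have sign: "d mod 4 = 1 \<Longrightarrow> (- 3 :: real) ^ k = 3 ^ k" "d mod 4 = 3 \<Longrightarrow> (- 3 :: real) ^ k = - (3 ^ k)"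
    proof -
      assume "d mod 4 = 1"
      then have "even k" using k by presburger
      then show "(- 3 :: real) ^ k = 3 ^ k" by simp
    next
      assume "d mod 4 = 3"
      then have "odd k" using k by presburger
      then show "(- 3 :: real) ^ k = - (3 ^ k)" by simp
    qed
    show "\<forall>v. v \<noteq> 0 \<and> - a4 = v ^ 4 \<longrightarrow>
             (trace3 d (a6 / v ^ 6) = 0 \<longrightarrow> N = q + 1) \<and>
             (trace3 d (a6 / v ^ 6) = 1 \<and> d mod 4 = 1 \<longrightarrow> N = q + 1 + sqrt (3 * q)) \<and>
             (trace3 d (a6 / v ^ 6) = 1 \<and> d mod 4 = 3 \<longrightarrow> N = q + 1 - sqrt (3 * q)) \<and>
             (trace3 d (a6 / v ^ 6) = -1 \<and> d mod 4 = 1 \<longrightarrow> N = q + 1 - sqrt (3 * q)) \<and>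
             (trace3 d (a6 / v ^ 6) = -1 \<and> d mod 4 = 3 \<longrightarrow> N = q + 1 + sqrt (3 * q))"
    proof (intro allI impI)
      fix v :: 'a
      assume v: "v \<noteq> 0 \<and> - a4 = v ^ 4"
      have "(v ^ 2) ^ 3 = v ^ 6" "- a4 = (v ^ 2) ^ 2"
        using v by (simp_all flip: power_mult)
      \<comment> \<open>Here \<open>v ^ 2\<close> serves as the square root of \<open>- a4\<close>;
        being a square, it may be replaced by 1 in the count.\<close>
      then have Nv: "N = 1 + 3 * real (trace_count d 1 (trace3 d (a6 / v ^ 6)))"
        using N_sq[of "v ^ 2"] v trace_count_square[OF card_nat, of v] by simp
      note counts = trace_count_odd[OF card_nat k]
      show "(trace3 d (a6 / v ^ 6) = 0 \<longrightarrow> N = q + 1) \<and>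
             (trace3 d (a6 / v ^ 6) = 1 \<and> d mod 4 = 1 \<longrightarrow> N = q + 1 + sqrt (3 * q)) \<and>
             (trace3 d (a6 / v ^ 6) = 1 \<and> d mod 4 = 3 \<longrightarrow> N = q + 1 - sqrt (3 * q)) \<and>
             (trace3 d (a6 / v ^ 6) = -1 \<and> d mod 4 = 1 \<longrightarrow> N = q + 1 - sqrt (3 * q)) \<and>
             (trace3 d (a6 / v ^ 6) = -1 \<and> d mod 4 = 3 \<longrightarrow> N = q + 1 + sqrt (3 * q))"
        unfolding root
      proof (intro conjI impI; (elim conjE)?)
        assume "trace3 d (a6 / v ^ 6) = 0"
        then show "N = q + 1" using Nv counts(1) q by simp
      next
        assume "trace3 d (a6 / v ^ 6) = 1" "d mod 4 = 1"
        then show "N = q + 1 + 3 * 3 ^ k" using Nv counts(2) q sign(1) by simp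
      next
        assume "trace3 d (a6 / v ^ 6) = 1" "d mod 4 = 3"
        then show "N = q + 1 - 3 * 3 ^ k" using Nv counts(2) q sign(2) by simp
      next
        assume "trace3 d (a6 / v ^ 6) = -1" "d mod 4 = 1"
        then show "N = q + 1 - 3 * 3 ^ k" using Nv counts(3) q sign(1) by simp
      next
        assume "trace3 d (a6 / v ^ 6) = -1" "d mod 4 = 3"
        then show "N = q + 1 + 3 * 3 ^ k" using Nv counts(3) q sign(2) by simp
      qed
    qed
    assume no: "\<nexists>v. v \<noteq> 0 \<and> - a4 = v ^ 4"
    \<comment> \<open>For odd \<open>d\<close> a square is a fourth power, so \<open>- a4\<close> is
      not even a square and the bijective case applies.\<close>
    have "- a4 \<noteq> g ^ 2" for g
    proof
      assume g: "- a4 = g ^ 2"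
      then have "g \<noteq> 0" using a4 by auto
      then obtain v where "- a4 = v ^ 4"
        using square_of_square_odd[OF card_nat \<open>odd d\<close>] g by metis
      then show False using no a4 by (cases "v = 0") auto
    qed
    then show "N = q + 1" by (intro N_nonsq) blast
  next
    assume "even d"
    then obtain k where k: "d = 2 * k" by (rule evenE)
    have root: "sqrt q = 3 ^ k"
      by (rule real_sqrt_unique) (simp_all add: q k mult.commute flip: power_mult)
    have sign: "d mod 4 = 0 \<Longrightarrow> (- 3 :: real) ^ k = 3 ^ k" "d mod 4 = 2 \<Longrightarrow> (- 3 :: real) ^ k = - (3 ^ k)"
    proof -
      assume "d mod 4 = 0"
      then have "even k" using k by presburger
      then show "(- 3 :: real) ^ k = 3 ^ k" by simp
    next
      assume "d mod 4 = 2"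
      then have "odd k" using k by presburger
      then show "(- 3 :: real) ^ k = - (3 ^ k)" by simp
    qed
    have count: "3 * real (trace_count d 1 t) = (if t = 0 then q - 2 * (- 3) ^ k else q + (- 3) ^ k)"
      if "t \<in> {0, 1, - 1 :: 'a}" for t
      using trace_count_even[OF card_nat k] that q by auto
    show "\<forall>\<gamma>. \<gamma> \<noteq> 0 \<and> - a4 = \<gamma> ^ 2 \<and> (\<exists>w. w \<noteq> 0 \<and> \<gamma> = w ^ 2) \<longrightarrow>
             (trace3 d (a6 / \<gamma> ^ 3) = 0 \<and> d mod 4 = 0 \<longrightarrow> N = q + 1 - 2 * sqrt q) \<and>
             (trace3 d (a6 / \<gamma> ^ 3) = 0 \<and> d mod 4 = 2 \<longrightarrow> N = q + 1 + 2 * sqrt q) \<and>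
             (trace3 d (a6 / \<gamma> ^ 3) \<noteq> 0 \<and> d mod 4 = 0 \<longrightarrow> N = q + 1 + sqrt q) \<and>
             (trace3 d (a6 / \<gamma> ^ 3) \<noteq> 0 \<and> d mod 4 = 2 \<longrightarrow> N = q + 1 - sqrt q)"
    proof (intro allI impI)
      fix \<gamma> :: 'a
      assume \<gamma>: "\<gamma> \<noteq> 0 \<and> - a4 = \<gamma> ^ 2 \<and> (\<exists>w. w \<noteq> 0 \<and> \<gamma> = w ^ 2)"
      define t where "t = trace3 d (a6 / \<gamma> ^ 3)"
      have "trace_count d \<gamma> t = trace_count d 1 t"
        using \<gamma> trace_count_square[OF card_nat] by metis
      then have "N = 1 + (if t = 0 then q - 2 * (- 3) ^ k else q + (- 3) ^ k)"
        using N_sq[of \<gamma>] \<gamma> count[of t] range by (simp add: t_def)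
      then show "(t = 0 \<and> d mod 4 = 0 \<longrightarrow> N = q + 1 - 2 * sqrt q) \<and>
             (t = 0 \<and> d mod 4 = 2 \<longrightarrow> N = q + 1 + 2 * sqrt q) \<and>
             (t \<noteq> 0 \<and> d mod 4 = 0 \<longrightarrow> N = q + 1 + sqrt q) \<and>
             (t \<noteq> 0 \<and> d mod 4 = 2 \<longrightarrow> N = q + 1 - sqrt q)"
        using sign unfolding root by (auto split: if_splits)
    qed
    show "\<forall>\<gamma>. \<gamma> \<noteq> 0 \<and> - a4 = \<gamma> ^ 2 \<and> (\<nexists>w. w \<noteq> 0 \<and> \<gamma> = w ^ 2) \<longrightarrow>
             (trace3 d (a6 / \<gamma> ^ 3) = 0 \<and> d mod 4 = 0 \<longrightarrow> N = q + 1 + 2 * sqrt q) \<and>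
             (trace3 d (a6 / \<gamma> ^ 3) = 0 \<and> d mod 4 = 2 \<longrightarrow> N = q + 1 - 2 * sqrt q) \<and>
             (trace3 d (a6 / \<gamma> ^ 3) \<noteq> 0 \<and> d mod 4 = 0 \<longrightarrow> N = q + 1 - sqrt q) \<and>
             (trace3 d (a6 / \<gamma> ^ 3) \<noteq> 0 \<and> d mod 4 = 2 \<longrightarrow> N = q + 1 + sqrt q)"
    proof (intro allI impI)
      fix \<gamma> :: 'a
      assume \<gamma>: "\<gamma> \<noteq> 0 \<and> - a4 = \<gamma> ^ 2 \<and> (\<nexists>w. w \<noteq> 0 \<and> \<gamma> = w ^ 2)"
      define t where "t = trace3 d (a6 / \<gamma> ^ 3)"
      have "\<nexists>w. \<gamma> = w ^ 2" using \<gamma> by (metis zero_power2)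
      \<comment> \<open>Complementation reflects the count for 1 about \<open>q\<close>, which
        reverses every sign of the preceding case.\<close>
      then have "3 * real (trace_count d \<gamma> t) = 2 * q - 3 * real (trace_count d 1 t)"
        using trace_count_nonsquare_real[OF card_nat _ range] by (simp add: t_def q)
      then have "N = 1 + (if t = 0 then q + 2 * (- 3) ^ k else q - (- 3) ^ k)"
        using N_sq[of \<gamma>] \<gamma> count[of t] range by (simp add: t_def)
      then show "(t = 0 \<and> d mod 4 = 0 \<longrightarrow> N = q + 1 + 2 * sqrt q) \<and>
             (t = 0 \<and> d mod 4 = 2 \<longrightarrow> N = q + 1 - 2 * sqrt q) \<and>
             (t \<noteq> 0 \<and> d mod 4 = 0 \<longrightarrow> N = q + 1 - sqrt q) \<and>
             (t \<noteq> 0 \<and> d mod 4 = 2 \<longrightarrow> N = q + 1 + sqrt q)"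
        using sign unfolding root by (auto split: if_splits)
    qed
    assume "\<nexists>\<gamma>. \<gamma> \<noteq> 0 \<and> - a4 = \<gamma> ^ 2"
    then show "N = q + 1" using a4 by (intro N_nonsq) (metis neg_equal_0_iff_equal zero_power2)
  qed
qed

end
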